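(* Let $X\ge 0$ be a random variable with continuous cdf $F$ and finite mean $\mu_F$, and let $X_1,X_2,\dots$ be i.i.d. copies of $X$. Then $\widehat{D}_n$ is a consistent estimator of $D_F$, i.e. $\widehat{D}_n \to D_F$ in probability as $n\to\infty$.
   Context: Quantile function: $F^{-1}(p)=\inf\{x: F(x)\ge p\}$, and $\mu_F=\int_0^1F^{-1}(p)\,dp$. The Lorenz curve is $l_F(p)=\frac1{\mu_F}\int_0^pF^{-1}(t)\,dt$, its dual is $m_F(p)=1-l_F(1-p)$, and the inequality index is $$D_F=\int_0^1\frac{m_F(p)-l_F(p)}{m_F(p)}\,dp .$$ Empirical versions: $F_n(x)=\frac1n\sum_{i=1}^n\mathbf 1_{[0,x]}(X_i)$, $\overline X_n=\frac1n\sum_{i=1}^nX_i$, $F_n^{-1}(s)=\inf\{x:F_n(x)\ge s\}$, $l_n(p)=\frac1{\overline X_n}\int_0^pF_n^{-1}(s)\,ds$, $m_n(p)=\frac1{\overline X_n}\int_{1-p}^1F_n^{-1}(s)\,ds$, and $$\widehat D_n=\int_0^1\frac{m_n(p)-l_n(p)}{m_n(p)}\,dp .$$ *)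

theory Defs
  imports "HOL-Probability.Probability"
begin

text \<open>All integrals below run over subsets of the unit interval.  At the end points the quantile
  function may be an infimum of an empty or unbounded set, and at \<open>p = 0\<close> the index integrands
  are of the form \<open>0 / 0\<close>; these points have measure zero and do not affect the integrals.\<close>

definition quantile :: "(real \<Rightarrow> real) \<Rightarrow> real \<Rightarrow> real" where
  "quantile F p = Inf {x. F x \<ge> p}"

definition quantile_mean :: "(real \<Rightarrow> real) \<Rightarrow> real" where
  "quantile_mean F = (LINT p:{0..1}|lborel. quantile F p)"

definition lorenz :: "(real \<Rightarrow> real) \<Rightarrow> real \<Rightarrow> real" where
  "lorenz F p = 1 / quantile_mean F * (LINT t:{0..p}|lborel. quantile F t)"

definition dual_lorenz :: "(real \<Rightarrow> real) \<Rightarrow> real \<Rightarrow> real" where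
  "dual_lorenz F p = 1 - lorenz F (1 - p)"

definition inequality_index :: "(real \<Rightarrow> real) \<Rightarrow> real" where
  "inequality_index F =
     (LINT p:{0..1}|lborel. (dual_lorenz F p - lorenz F p) / dual_lorenz F p)"

text \<open>The empirical versions are functions of the sample size \<open>n\<close> and of a sequence of observations
  \<open>x\<close>, of which only \<open>x 1, \<dots>, x n\<close> are used.\<close>

definition empirical_cdf :: "nat \<Rightarrow> (nat \<Rightarrow> real) \<Rightarrow> real \<Rightarrow> real" where
  "empirical_cdf n x t = 1 / real n * (\<Sum>i=1..n. indicator {0..t} (x i))"

definition sample_mean :: "nat \<Rightarrow> (nat \<Rightarrow> real) \<Rightarrow> real" where
  "sample_mean n x = 1 / real n * (\<Sum>i=1..n. x i)"

definition empirical_lorenz :: "nat \<Rightarrow> (nat \<Rightarrow> real) \<Rightarrow> real \<Rightarrow> real" where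
  "empirical_lorenz n x p =
     1 / sample_mean n x * (LINT s:{0..p}|lborel. quantile (empirical_cdf n x) s)"

definition empirical_dual_lorenz :: "nat \<Rightarrow> (nat \<Rightarrow> real) \<Rightarrow> real \<Rightarrow> real" where
  "empirical_dual_lorenz n x p =
     1 / sample_mean n x * (LINT s:{1-p..1}|lborel. quantile (empirical_cdf n x) s)"

definition empirical_inequality_index :: "nat \<Rightarrow> (nat \<Rightarrow> real) \<Rightarrow> real" where
  "empirical_inequality_index n x =
     (LINT p:{0..1}|lborel.
        (empirical_dual_lorenz n x p - empirical_lorenz n x p) / empirical_dual_lorenz n x p)"

text \<open>Measurability is part of the notion: \<^const>\<open>measure\<close> is \<open>0\<close> on non-measurable sets, so the
  limit condition alone could hold vacuously.\<close>

definition converges_in_probability :: "'a measure \<Rightarrow> (nat \<Rightarrow> 'a \<Rightarrow> real) \<Rightarrow> real \<Rightarrow> bool" where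
  "converges_in_probability M Y c \<longleftrightarrow>
     (\<forall>n. Y n \<in> borel_measurable M) \<and>
     (\<forall>\<epsilon>>0. (\<lambda>n. measure M {\<omega> \<in> space M. \<bar>Y n \<omega> - c\<bar> > \<epsilon>}) \<longlonglongrightarrow> 0)"

end

theory Submission
  imports Defs
begin

text \<open>
The index depends continuously on the distribution function in the Wasserstein distance
\<open>\<Delta> = \<integral>\<^sub>0\<^sup>\<infinity> \<bar>F\<^sub>n(x) - F(x)\<bar> dx\<close>, and \<open>\<Delta>\<close> tends to \<open>0\<close> in mean.

Let \<open>L(p)\<close> and \<open>U(p)\<close> be the integrals of the quantile function over \<open>[0, p]\<close> and
\<open>[1 - p, 1]\<close>. The normalisation cancels in the index, which therefore is
\<open>\<integral>\<^sub>0\<^sup>1 (1 - L(p) / U(p)) dp\<close>. Exchanging the order of integration gives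
\<open>L(p) = \<integral>\<^sub>0\<^sup>\<infinity> max 0 (p - F(x)) dx\<close> and \<open>U(p) = \<integral>\<^sub>0\<^sup>\<infinity> min p (1 - F(x)) dx\<close>
(lemmas \<open>quantile_integral\<close> and \<open>quantile_integral_top\<close>). Both change by at most \<open>\<Delta>\<close> when \<open>F\<close>
is replaced by \<open>F\<^sub>n\<close>. Moreover \<open>0 \<le> L \<le> U\<close> and \<open>U(p) \<ge> p \<mu>\<close> for the mean \<open>\<mu>\<close>, so the ratios
\<open>L / U\<close> lie in \<open>[0, 1]\<close> and differ by at most \<open>2 \<Delta> / (p \<mu>)\<close>. Splitting the integral at \<open>\<eta>\<close>
bounds the error of the index by \<open>\<eta> + 2 \<Delta> / (\<eta> \<mu>)\<close> (lemma \<open>index_integral_diff\<close>). Continuity of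
\<open>F\<close> enters through \<open>\<mu> > 0\<close>.

By Tonelli's theorem, the mean of \<open>\<Delta>\<close> is the integral over \<open>x \<ge> 0\<close> of the mean deviation
\<open>E \<bar>F\<^sub>n(x) - F(x)\<bar>\<close>. This is at most \<open>1 / sqrt n\<close> by independence, and at most
\<open>2 (1 - F(x))\<close>, which is integrable because \<open>X\<close> has a finite mean. Dominated convergence
(lemma \<open>expected_distance_tendsto_0\<close>) and Markov's inequality finish the proof.

Measurability of the estimator has to be shown at all sample points, including those where
an observation is negative; there it follows from a direct description of the sublevel sets of a
random quantile (lemma \<open>borel_measurable_quantile\<close>).
\<close>

section \<open>Quantile functions and their measurability\<close>

text \<open>Right-continuous increasing functions that vanish on the negative half-line, with no condition at
\<open>\<infinity>\<close>. The condition at infinity is left out because \<^const>\<open>empirical_cdf\<close> counts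
only observations in \<open>[0, t]\<close>: on the null event that some observation is negative its limit is
below \<open>1\<close>, yet measurability of the estimator has to be shown at those sample points as well.\<close>

locale defective_cdf =
  fixes G :: "real \<Rightarrow> real"
  assumes mono: "mono G"
    and right_cont: "continuous (at_right x) G"
    and zero_below: "x < 0 \<Longrightarrow> G x = 0"
begin

lemma nonneg: "0 \<le> G x"
proof -
  have "G (min x (-1)) = 0" by (rule zero_below) auto
  then show ?thesis using monoD[OF mono, of "min x (-1)" x] by simp
qed

lemma measurable_G [measurable]: "G \<in> borel_measurable borel"
  using mono by (rule borel_measurable_mono)

text \<open>Right-continuity makes \<open>{x. t \<le> G x}\<close> a closed half-line, so that its infimum belongs to it. The
witness \<open>y\<close> and \<open>0 < t\<close> keep the set non-empty and bounded below; without them the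
infimum is a default value.\<close>

lemma quantile_le_iff:
  assumes "0 < t" "t \<le> G y"
  shows "quantile G t \<le> x \<longleftrightarrow> t \<le> G x"
proof
  have bdd: "bdd_below {x. G x \<ge> t}"
  proof (rule bdd_belowI[of _ 0])
    fix s assume "s \<in> {x. t \<le> G x}"
    then show "0 \<le> s" using assms(1) zero_below[of s] by (cases "s < 0") auto
  qed
  show "t \<le> G x \<Longrightarrow> quantile G t \<le> x"
    unfolding quantile_def using bdd by (auto intro: cInf_lower)
  assume le: "quantile G t \<le> x"
  have above: "t \<le> G z" if "x < z" for z
  proof -
    have "Inf {x. G x \<ge> t} < z" using le that by (simp add: quantile_def)
    then obtain s where "t \<le> G s" "s < z"
      using cInf_less_iff[OF _ bdd] assms(2) by blast
    then show ?thesis using monoD[OF mono, of s z] by simp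
  qed
  show "t \<le> G x"
  proof (rule tendsto_lowerbound)
    show "(G \<longlongrightarrow> G x) (at_right x)" using right_cont by (simp add: continuous_within)
    show "\<forall>\<^sub>F z in at_right x. t \<le> G z"
      using eventually_at_right_less[of x] by eventually_elim (rule above)
  qed auto
qed

end

text \<open>For a random cdf \<open>H\<close> and a random level \<open>f\<close>, the event \<open>quantile (H z) (f z) \<le> y\<close> is
\<open>f z \<le> H z y\<close> by the preceding equivalence, except where the level is non-positive or never attained;
there the quantile is one of the two constants \<open>Inf UNIV\<close> and \<open>Inf {}\<close>. By monotonicity,
attainment can be tested at the natural numbers, which keeps the exceptional event measurable.\<close>

lemma borel_measurable_quantile:
  assumes H: "\<And>z. defective_cdf (H z)"
    and [measurable]: "\<And>y. (\<lambda>z. H z y) \<in> borel_measurable K" "f \<in> borel_measurable K"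
  shows "(\<lambda>z. quantile (H z) (f z)) \<in> borel_measurable K"
  unfolding borel_measurable_iff_le
proof
  fix y
  have eq: "quantile (H z) (f z) \<le> y \<longleftrightarrow>
      (if f z \<le> 0 then Inf (UNIV :: real set) \<le> y
       else if \<exists>k. f z \<le> H z (real k) then f z \<le> H z y else Inf ({} :: real set) \<le> y)" for z
  proof -
    interpret defective_cdf "H z" by (rule H)
    show ?thesis
    proof (cases "f z \<le> 0")
      case True
      then have "{x. H z x \<ge> f z} = UNIV" using nonneg order_trans by blast
      with True show ?thesis by (simp add: quantile_def)
    next
      case pos: False
      show ?thesis
      proof (cases "\<exists>k. f z \<le> H z (real k)")
        case True
        then obtain k where "f z \<le> H z (real k)" by blast
        with pos quantile_le_iff[of "f z" "real k" y] True show ?thesis by simp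
      next
        case False
        have "\<not> f z \<le> H z x" for x
          using monoD[OF mono real_nat_ceiling_ge[of x]] False order_trans by blast
        then have "{x. H z x \<ge> f z} = {}" by blast
        with pos False show ?thesis by (simp add: quantile_def)
      qed
    qed
  qed
  show "{w \<in> space K. quantile (H w) (f w) \<le> y} \<in> sets K"
    unfolding eq by measurable
qed

section \<open>Unnormalised Lorenz curves as integrals of the cdf\<close>

text \<open>\<open>bottom_income G p\<close> is \<open>\<integral>\<^sub>0\<^sup>p G\<^sup>-\<^sup>1(t) dt\<close>, the total income of the poorest
fraction \<open>p\<close>, written without the quantile function. This form is Lipschitz in \<open>G\<close>
under the integral sign. The identity with the quantile integral is \<open>quantile_integral\<close> below.\<close>

definition bottom_income :: "(real \<Rightarrow> real) \<Rightarrow> real \<Rightarrow> real" where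
  "bottom_income G p = (LINT x:{0..}|lborel. max 0 (p - G x))"

text \<open>Likewise \<open>\<integral> G\<^sup>-\<^sup>1(t) dt\<close> over \<open>[1 - p, 1]\<close>, the total income of the richest fraction \<open>p\<close>.\<close>

definition top_income :: "(real \<Rightarrow> real) \<Rightarrow> real \<Rightarrow> real" where
  "top_income G p = (LINT x:{0..}|lborel. min p (1 - G x))"

text \<open>The Wasserstein distance of order one between distributions on the half-line.\<close>

definition cdf_distance :: "(real \<Rightarrow> real) \<Rightarrow> (real \<Rightarrow> real) \<Rightarrow> real" where
  "cdf_distance G H = (LINT x:{0..}|lborel. \<bar>G x - H x\<bar>)"

lemma set_integrable_bounded_by:
  fixes f g :: "real \<Rightarrow> real"
  assumes "set_integrable lborel A g" "f \<in> borel_measurable borel" "A \<in> sets borel"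
    and "\<And>x. x \<in> A \<Longrightarrow> \<bar>f x\<bar> \<le> g x"
  shows "set_integrable lborel A f"
  using assms(1)
proof (rule set_integrable_bound)
  show "set_borel_measurable lborel A f"
    using assms(2,3) by (simp add: set_borel_measurable_def)
  show "AE x in lborel. x \<in> A \<longrightarrow> norm (f x) \<le> norm (g x)"
  proof (intro AE_I2 impI)
    fix x assume "x \<in> A"
    then show "norm (f x) \<le> norm (g x)" using assms(4)[of x] by simp
  qed
qed

locale nonneg_cdf = defective_cdf +
  assumes lim_top: "(G \<longlongrightarrow> 1) at_top"
    and integrable_tail: "set_integrable lborel {0..} (\<lambda>x. 1 - G x)"
begin

lemma le_1: "G x \<le> 1"
proof (rule tendsto_lowerbound[OF lim_top])
  show "\<forall>\<^sub>F y in at_top. G x \<le> G y"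
    using eventually_ge_at_top[of x] by (rule eventually_mono) (rule monoD[OF mono])
  show "at_top \<noteq> (bot :: real filter)" by simp
qed

lemma reached: assumes "t < 1" shows "\<exists>y. t \<le> G y"
proof -
  have "\<forall>\<^sub>F y in at_top. t < G y" by (rule order_tendstoD(1)[OF lim_top assms])
  then show ?thesis unfolding eventually_at_top_linorder using less_imp_le by blast
qed

lemma quantile_measurable [measurable]: "quantile G \<in> borel_measurable borel"
proof (rule borel_measurable_quantile[where H = "\<lambda>_. G" and f = "\<lambda>x. x"])
  show "defective_cdf G" by (rule defective_cdf_axioms)
qed simp_all

lemma less_quantile_iff: "0 < t \<Longrightarrow> t < 1 \<Longrightarrow> x < quantile G t \<longleftrightarrow> G x < t"
  using quantile_le_iff[of t] reached[of t] by (meson not_le)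

lemma quantile_nonneg: "0 < t \<Longrightarrow> t < 1 \<Longrightarrow> 0 \<le> quantile G t"
  using less_quantile_iff[of t "quantile G t"] zero_below[of "quantile G t"] by force

lemma integrable_bottom: "p \<le> 1 \<Longrightarrow> set_integrable lborel {0..} (\<lambda>x. max 0 (p - G x))"
  by (rule set_integrable_bounded_by[OF integrable_tail]) (use le_1 in \<open>auto simp: max_def\<close>)

lemma integrable_top: "0 \<le> p \<Longrightarrow> set_integrable lborel {0..} (\<lambda>x. min p (1 - G x))"
  by (rule set_integrable_bounded_by[OF integrable_tail]) (use le_1 in \<open>auto simp: min_def\<close>)

text \<open>Layer-cake decomposition: \<open>G\<^sup>-\<^sup>1(t)\<close> is the length of \<open>{x \<ge> 0. G x < t}\<close>. After
exchanging the integrals, a fixed \<open>x\<close> contributes the length of \<open>{t. G x < t < p}\<close>. The open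
interval avoids the levels \<open>0\<close> and \<open>1\<close>, where the quantile may be a default value.\<close>

lemma nn_integral_quantile:
  assumes "0 \<le> p" "p \<le> 1"
  shows "(\<integral>\<^sup>+t. ennreal (indicator {0<..<p} t * quantile G t) \<partial>lborel) = ennreal (bottom_income G p)"
proof -
  have "(\<integral>\<^sup>+t. ennreal (indicator {0<..<p} t * quantile G t) \<partial>lborel) =
        (\<integral>\<^sup>+t. \<integral>\<^sup>+x. indicator {0<..<p} t * (indicator {0..} x * indicator {G x<..} t) \<partial>lborel \<partial>lborel)"
  proof (rule nn_integral_cong)
    fix t :: real
    show "ennreal (indicator {0<..<p} t * quantile G t) =
          (\<integral>\<^sup>+x. indicator {0<..<p} t * (indicator {0..} x * indicator {G x<..} t) \<partial>lborel)"
    proof (cases "t \<in> {0<..<p}")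
      case True
      then have t: "0 < t" "t < 1" using assms by auto
      have "(\<integral>\<^sup>+x. indicator {0<..<p} t * (indicator {0..} x * indicator {G x<..} t) \<partial>lborel)
          = (\<integral>\<^sup>+x. indicator {0..<quantile G t} x \<partial>lborel)"
        using True by (intro nn_integral_cong)
          (auto simp: less_quantile_iff[OF t] split: split_indicator)
      also have "\<dots> = ennreal (quantile G t)" using quantile_nonneg[OF t] by simp
      finally show ?thesis using True by simp
    qed auto
  qed
  also have "\<dots> = (\<integral>\<^sup>+x. \<integral>\<^sup>+t. indicator {0<..<p} t * (indicator {0..} x * indicator {G x<..} t) \<partial>lborel \<partial>lborel)"
    by (rule lborel_pair.Fubini') (simp add: indicator_def greaterThan_iff, measurable)
  also have "\<dots> = (\<integral>\<^sup>+x. ennreal (indicator {0..} x * max 0 (p - G x)) \<partial>lborel)"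
  proof (rule nn_integral_cong)
    fix x :: real
    have "(\<integral>\<^sup>+t. indicator {0<..<p} t * (indicator {0..} x * indicator {G x<..} t) \<partial>lborel) =
          (\<integral>\<^sup>+t. indicator {0..} x * indicator {G x<..<p} t \<partial>lborel)"
      using nonneg[of x] by (intro nn_integral_cong) (auto split: split_indicator)
    also have "\<dots> = indicator {0..} x * emeasure lborel {G x<..<p}"
      by (simp add: nn_integral_cmult)
    also have "\<dots> = ennreal (indicator {0..} x * max 0 (p - G x))"
      by (cases "G x \<le> p") (auto simp: ennreal_mult' max_def split: split_indicator)
    finally show "(\<integral>\<^sup>+t. indicator {0<..<p} t * (indicator {0..} x * indicator {G x<..} t) \<partial>lborel) =
      ennreal (indicator {0..} x * max 0 (p - G x))" .
  qed
  also have "\<dots> = ennreal (bottom_income G p)"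
    unfolding bottom_income_def set_lebesgue_integral_def real_scaleR_def
    using integrable_bottom[OF assms(2)]
    by (intro nn_integral_eq_integral) (auto simp: set_integrable_def)
  finally show ?thesis .
qed

lemma quantile_integral_open:
  assumes "0 \<le> p" "p \<le> 1"
  shows "set_integrable lborel {0<..<p} (quantile G)"
    and "(LINT t:{0<..<p}|lborel. quantile G t) = bottom_income G p"
proof -
  have nn: "AE t in lborel. 0 \<le> indicator {0<..<p} t * quantile G t"
    using quantile_nonneg assms by (auto split: split_indicator)
  have "0 \<le> bottom_income G p"
    unfolding bottom_income_def set_lebesgue_integral_def by (rule integral_nonneg_AE) auto
  then have "has_bochner_integral lborel (\<lambda>t. indicator {0<..<p} t * quantile G t) (bottom_income G p)"
    using nn_integral_quantile[OF assms] nn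
    by (intro has_bochner_integral_nn_integral) auto
  then show "set_integrable lborel {0<..<p} (quantile G)"
    "(LINT t:{0<..<p}|lborel. quantile G t) = bottom_income G p"
    by (auto simp: set_integrable_def set_lebesgue_integral_def has_bochner_integral_iff)
qed

lemma quantile_integral:
  assumes "0 \<le> p" "p \<le> 1"
  shows "set_integrable lborel {0..p} (quantile G)"
    and "(LINT t:{0..p}|lborel. quantile G t) = bottom_income G p"
proof -
  have *: "{0..p} - {0<..<p} \<union> ({0<..<p} - {0..p}) \<subseteq> {0, p}"
  proof
    fix t assume "t \<in> {0..p} - {0<..<p} \<union> ({0<..<p} - {0..p})"
    then have "t = 0 \<or> t = p" unfolding Un_iff Diff_iff atLeastAtMost_iff greaterThanLessThan_iff by linarith
    then show "t \<in> {0, p}" by simp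
  qed
  have "set_integrable lborel {0..p} (quantile G) = set_integrable lborel {0<..<p} (quantile G)"
    by (rule set_integrable_discrete_difference[OF _ *]) simp_all
  then show "set_integrable lborel {0..p} (quantile G)"
    using quantile_integral_open(1)[OF assms] by simp
  have "(LINT t:{0..p}|lborel. quantile G t) = (LINT t:{0<..<p}|lborel. quantile G t)"
    by (rule set_integral_discrete_difference[OF _ *]) simp_all
  then show "(LINT t:{0..p}|lborel. quantile G t) = bottom_income G p"
    using quantile_integral_open(2)[OF assms] by simp
qed

lemma bottom_plus_top:
  assumes "0 \<le> p" "p \<le> 1"
  shows "bottom_income G (1 - p) + top_income G p = bottom_income G 1"
proof -
  have "bottom_income G (1 - p) + top_income G p =
      (LINT x:{0..}|lborel. max 0 (1 - p - G x) + min p (1 - G x))"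
    unfolding bottom_income_def top_income_def
    by (rule set_integral_add(2)[symmetric]) (use integrable_bottom integrable_top assms in simp_all)
  also have "\<dots> = bottom_income G 1" unfolding bottom_income_def
    using le_1 by (intro set_lebesgue_integral_cong) (auto simp: max_def min_def)
  finally show ?thesis .
qed

lemma quantile_integral_top:
  assumes "0 \<le> p" "p \<le> 1"
  shows "(LINT t:{1-p..1}|lborel. quantile G t) = top_income G p"
proof -
  have sub: "set_integrable lborel {1-p..1} (quantile G)" "set_integrable lborel {0..1-p} (quantile G)"
    by (rule set_integrable_subset[OF quantile_integral(1)[of 1]]; use assms in auto)+
  have "(LINT t:{0..1-p} \<union> {1-p..1}|lborel. quantile G t) =
    (LINT t:{0..1-p}|lborel. quantile G t) + (LINT t:{1-p..1}|lborel. quantile G t)"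
  proof (intro set_integral_Un_AE sub)
    show "AE t in lborel. \<not> (t \<in> {0..1-p} \<and> t \<in> {1-p..1})"
      using AE_lborel_singleton[of "1-p"] by eventually_elim auto
  qed auto
  moreover have "{0..1-p} \<union> {1-p..1} = {0..1}" using assms by auto
  ultimately show ?thesis
    using quantile_integral(2)[of 1] quantile_integral(2)[of "1-p"] bottom_plus_top[OF assms] assms by auto
qed

lemma mean_eq: "quantile_mean G = bottom_income G 1"
  unfolding quantile_mean_def using quantile_integral[of 1] by simp

lemma bottom_nonneg: "0 \<le> bottom_income G p"
  unfolding bottom_income_def set_lebesgue_integral_def by (rule integral_nonneg_AE) auto

lemma bottom_le_top:
  assumes "0 \<le> p" "p \<le> 1" shows "bottom_income G p \<le> top_income G p"
  unfolding bottom_income_def top_income_def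
proof (rule set_integral_mono)
  show "max 0 (p - G x) \<le> min p (1 - G x)" for x
    using assms nonneg[of x] le_1[of x] by (auto simp: max_def min_def)
qed (use integrable_bottom integrable_top assms in simp_all)

text \<open>Both arguments of the minimum dominate \<open>p (1 - G x)\<close>, because \<open>p\<close> and \<open>1 - G x\<close> lie in
\<open>[0, 1]\<close>. In terms of incomes: the richest fraction \<open>p\<close> owns at least the share \<open>p\<close>.
This is the lower bound on the denominator of the index integrand.\<close>

lemma top_ge:
  assumes "0 \<le> p" "p \<le> 1" shows "p * quantile_mean G \<le> top_income G p"
proof -
  have "p * quantile_mean G = (LINT x:{0..}|lborel. p * (1 - G x))"
    unfolding mean_eq bottom_income_def using le_1 by (simp add: max_def)
  also have "\<dots> \<le> top_income G p" unfolding top_income_def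
  proof (rule set_integral_mono)
    fix x
    have "p * (1 - G x) \<le> p" "p * (1 - G x) \<le> 1 - G x"
      using assms nonneg[of x] le_1[of x] by (auto intro: mult_left_le mult_left_le_one_le)
    then show "p * (1 - G x) \<le> min p (1 - G x)" by simp
  qed (use integrable_tail integrable_top assms in simp_all)
  finally show ?thesis .
qed

lemma measurable_bottom [measurable]: "bottom_income G \<in> borel_measurable borel"
  unfolding bottom_income_def[abs_def] set_lebesgue_integral_def by measurable

lemma measurable_top [measurable]: "top_income G \<in> borel_measurable borel"
  unfolding top_income_def[abs_def] set_lebesgue_integral_def by measurable

end

section \<open>The index as an integral of a bounded ratio\<close>

definition income_ratio :: "(real \<Rightarrow> real) \<Rightarrow> real \<Rightarrow> real" where
  "income_ratio G p = bottom_income G p / top_income G p"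

text \<open>The index integrands are \<open>0 / 0\<close> at \<open>p = 0\<close>, so they can only be compared on \<open>(0, 1]\<close>.\<close>

lemma unit_integral_cong:
  fixes f g :: "real \<Rightarrow> real"
  assumes "\<And>p. 0 < p \<Longrightarrow> p \<le> 1 \<Longrightarrow> f p = g p"
  shows "(LINT p:{0..1}|lborel. f p) = (LINT p:{0..1}|lborel. g p)"
  unfolding set_lebesgue_integral_def
  by (rule integral_discrete_difference[where X = "{0}"]) (use assms in \<open>auto split: split_indicator\<close>)

lemma set_integrable_const_Icc: "set_integrable lborel {a..b :: real} (\<lambda>_. k :: real)"
  unfolding set_integrable_def real_scaleR_def
  by (intro integrable_mult_left integrable_real_indicator) (simp_all add: emeasure_lborel_Icc_eq)

context nonneg_cdf
begin

lemma income_ratio_bounds: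
  assumes "0 \<le> p" "p \<le> 1" shows "0 \<le> income_ratio G p" "income_ratio G p \<le> 1"
  using bottom_nonneg[of p] bottom_le_top[OF assms]
  unfolding income_ratio_def by (auto simp: divide_le_eq_1)

lemma integrable_income_ratio: "set_integrable lborel {0..1} (income_ratio G)"
proof (rule set_integrable_bounded_by)
  show "set_integrable lborel {0..1 :: real} (\<lambda>_. 1 :: real)" by (rule set_integrable_const_Icc)
  show "income_ratio G \<in> borel_measurable borel" unfolding income_ratio_def[abs_def] by measurable
qed (use income_ratio_bounds in auto)

text \<open>The normalising constant cancels in \<open>(m - l) / m\<close>. It is kept arbitrary since the theoretical
index divides by \<^const>\<open>quantile_mean\<close> and the empirical one by \<^const>\<open>sample_mean\<close>.\<close>

lemma integral_normalised_ratio: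
  assumes "0 < quantile_mean G" "c \<noteq> 0"
    and "\<And>p. 0 < p \<Longrightarrow> p \<le> 1 \<Longrightarrow> m p = top_income G p / c"
    and "\<And>p. 0 < p \<Longrightarrow> p \<le> 1 \<Longrightarrow> l p = bottom_income G p / c"
  shows "(LINT p:{0..1}|lborel. (m p - l p) / m p) = (LINT p:{0..1}|lborel. 1 - income_ratio G p)"
proof (rule unit_integral_cong)
  fix p :: real assume p: "0 < p" "p \<le> 1"
  then have "0 < p * quantile_mean G" using assms(1) by simp
  then have "0 < top_income G p" using top_ge[of p] p by linarith
  then show "(m p - l p) / m p = 1 - income_ratio G p"
    using assms(2) by (simp add: assms(3,4)[OF p] income_ratio_def field_simps)
qed

lemma inequality_index_eq:
  assumes "0 < quantile_mean G"
  shows "inequality_index G = (LINT p:{0..1}|lborel. 1 - income_ratio G p)"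
  unfolding inequality_index_def
proof (rule integral_normalised_ratio[where c = "quantile_mean G"])
  fix p :: real assume p: "0 < p" "p \<le> 1"
  show "lorenz G p = bottom_income G p / quantile_mean G"
    using quantile_integral(2)[of p] p by (simp add: lorenz_def)
  show "dual_lorenz G p = top_income G p / quantile_mean G"
    using quantile_integral(2)[of "1 - p"] bottom_plus_top[of p] p assms
    by (simp add: dual_lorenz_def lorenz_def mean_eq field_simps)
qed (use assms in simp_all)

end

section \<open>Stability of the index under the Wasserstein distance\<close>

locale nonneg_cdf_pair = G: nonneg_cdf G + H: nonneg_cdf H for G H
begin

lemma integrable_distance: "set_integrable lborel {0..} (\<lambda>x. \<bar>G x - H x\<bar>)"
proof (rule set_integrable_bounded_by)
  show "set_integrable lborel {0..} (\<lambda>x. (1 - G x) + (1 - H x))"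
    using G.integrable_tail H.integrable_tail by (rule set_integral_add)
  show "\<bar>\<bar>G x - H x\<bar>\<bar> \<le> (1 - G x) + (1 - H x)" for x
    using G.le_1[of x] H.le_1[of x] by linarith
qed auto

lemma distance_nonneg: "0 \<le> cdf_distance G H"
  unfolding cdf_distance_def set_lebesgue_integral_def by (rule integral_nonneg_AE) auto

lemma abs_integral_diff_le_distance:
  fixes f g :: "real \<Rightarrow> real"
  assumes "set_integrable lborel {0..} f" "set_integrable lborel {0..} g"
    and "\<And>x. \<bar>f x - g x\<bar> \<le> \<bar>G x - H x\<bar>"
  shows "\<bar>(LINT x:{0..}|lborel. f x) - (LINT x:{0..}|lborel. g x)\<bar> \<le> cdf_distance G H"
proof -
  have int: "set_integrable lborel {0..} (\<lambda>x. f x - g x)" using assms(1,2) by (rule set_integral_diff)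
  have "\<bar>(LINT x:{0..}|lborel. f x) - (LINT x:{0..}|lborel. g x)\<bar> = \<bar>LINT x:{0..}|lborel. f x - g x\<bar>"
    using assms(1,2) by (simp only: set_integral_diff(2))
  also have "\<dots> \<le> (LINT x:{0..}|lborel. \<bar>f x - g x\<bar>)"
    using set_integral_norm_bound[OF int] by simp
  also have "\<dots> \<le> cdf_distance G H" unfolding cdf_distance_def
    by (rule set_integral_mono[OF set_integrable_abs[OF int] integrable_distance assms(3)])
  finally show ?thesis .
qed

lemma bottom_diff: "p \<le> 1 \<Longrightarrow> \<bar>bottom_income G p - bottom_income H p\<bar> \<le> cdf_distance G H"
  unfolding bottom_income_def
  by (intro abs_integral_diff_le_distance G.integrable_bottom H.integrable_bottom) (auto simp: max_def)

lemma top_diff: "0 \<le> p \<Longrightarrow> \<bar>top_income G p - top_income H p\<bar> \<le> cdf_distance G H"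
  unfolding top_income_def
  by (intro abs_integral_diff_le_distance G.integrable_top H.integrable_top) (auto simp: min_def)

lemma mean_diff: "\<bar>quantile_mean G - quantile_mean H\<bar> \<le> cdf_distance G H"
  unfolding G.mean_eq H.mean_eq by (rule bottom_diff) simp

text \<open>With \<open>q = L / U\<close> one has \<open>(q - L' / U') U' = (L - L') + q (U' - U)\<close>, and \<open>q \<le> 1\<close>. Hence
only the denominator of \<open>H\<close> has to be bounded below; that of \<open>G\<close>, in the application the random
one, may even vanish.\<close>

lemma income_ratio_diff:
  assumes p: "0 < p" "p \<le> 1" and H: "0 < quantile_mean H"
  shows "\<bar>income_ratio G p - income_ratio H p\<bar> \<le> 2 * cdf_distance G H / (p * quantile_mean H)"
proof -
  define L L' U U' where "L = bottom_income G p" "L' = bottom_income H p"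
    "U = top_income G p" "U' = top_income H p"
  note defs = this
  let ?d = "cdf_distance G H"
  have low: "p * quantile_mean H \<le> U'" "0 < p * quantile_mean H"
    using H.top_ge[of p] p H by (auto simp: defs)
  then have U': "0 < U'" by linarith
  have d: "\<bar>L - L'\<bar> \<le> ?d" "\<bar>U - U'\<bar> \<le> ?d"
    using bottom_diff[of p] top_diff[of p] p by (auto simp: defs)
  have LU: "0 \<le> L" "L \<le> U"
    using G.bottom_nonneg[of p] G.bottom_le_top[of p] p by (auto simp: defs)
  define q where "q = L / U"
  have q: "0 \<le> q" "q \<le> 1" using LU by (auto simp: q_def divide_le_eq_1)
  \<comment> \<open>If \<open>U = 0\<close>, then \<open>L = 0\<close> by \<open>0 \<le> L \<le> U\<close>, in agreement with \<open>q = 0\<close>.\<close>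
  have "q * U = L" using LU by (cases "U = 0") (auto simp: q_def)
  then have "(q - L' / U') * U' = (L - L') + q * (U' - U)"
    using U' by (simp add: algebra_simps)
  then have "\<bar>q - L' / U'\<bar> * U' = \<bar>(L - L') + q * (U' - U)\<bar>"
    using U' by (metis abs_mult abs_of_pos)
  also have "\<dots> \<le> \<bar>L - L'\<bar> + q * \<bar>U' - U\<bar>"
    using q by (metis abs_mult abs_of_nonneg abs_triangle_ineq)
  also have "\<dots> \<le> \<bar>L - L'\<bar> + \<bar>U' - U\<bar>" using q by (simp add: mult_left_le_one_le)
  finally have "\<bar>q - L' / U'\<bar> * U' \<le> 2 * ?d" using d by (simp add: abs_minus_commute)
  then have "\<bar>q - L' / U'\<bar> \<le> 2 * ?d / U'" using U' by (simp add: pos_le_divide_eq)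
  also have "\<dots> \<le> 2 * ?d / (p * quantile_mean H)"
    using low distance_nonneg by (intro divide_left_mono) auto
  finally show ?thesis by (simp add: income_ratio_def q_def defs)
qed

text \<open>The bound on the ratios is not integrable at \<open>p = 0\<close>. On \<open>[0, \<eta>]\<close> the trivial
bound \<open>1\<close> is used instead, at the cost of \<open>\<eta>\<close>.\<close>

lemma index_integral_diff:
  assumes H: "0 < quantile_mean H" and \<eta>: "0 < \<eta>"
  shows "\<bar>(LINT p:{0..1}|lborel. 1 - income_ratio G p) - (LINT p:{0..1}|lborel. 1 - income_ratio H p)\<bar>
     \<le> \<eta> + 2 * cdf_distance G H / (\<eta> * quantile_mean H)"
proof -
  define c where "c = 2 * cdf_distance G H / (\<eta> * quantile_mean H)"
  have c: "0 \<le> c" using H \<eta> distance_nonneg by (simp add: c_def)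
  have one: "set_integrable lborel {0..1::real} (\<lambda>_. k :: real)" for k
    by (rule set_integrable_const_Icc)
  have ind: "set_integrable lborel {0..1} (indicat_real {0..\<eta>})"
    by (rule set_integrable_bounded_by[OF one[of 1]]) (auto split: split_indicator)
  have int: "set_integrable lborel {0..1} (\<lambda>p. 1 - income_ratio G p)"
    "set_integrable lborel {0..1} (\<lambda>p. 1 - income_ratio H p)"
    using one G.integrable_income_ratio H.integrable_income_ratio by (auto intro: set_integral_diff)
  have int2: "set_integrable lborel {0..1} (\<lambda>p. (1 - income_ratio G p) - (1 - income_ratio H p))"
    using int by (rule set_integral_diff)
  have "\<bar>(LINT p:{0..1}|lborel. 1 - income_ratio G p) - (LINT p:{0..1}|lborel. 1 - income_ratio H p)\<bar>
     = \<bar>LINT p:{0..1}|lborel. (1 - income_ratio G p) - (1 - income_ratio H p)\<bar>"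
    using int by (simp only: set_integral_diff(2))
  also have "\<dots> \<le> (LINT p:{0..1}|lborel. \<bar>(1 - income_ratio G p) - (1 - income_ratio H p)\<bar>)"
    using set_integral_norm_bound[OF int2] by simp
  also have "\<dots> \<le> (LINT p:{0..1}|lborel. indicator {0..\<eta>} p + c)"
  proof (rule set_integral_mono)
    fix p :: real assume p: "p \<in> {0..1}"
    have e: "\<bar>(1 - income_ratio G p) - (1 - income_ratio H p)\<bar> = \<bar>income_ratio G p - income_ratio H p\<bar>"
      by linarith
    show "\<bar>(1 - income_ratio G p) - (1 - income_ratio H p)\<bar> \<le> indicator {0..\<eta>} p + c"
    proof (cases "p \<le> \<eta>")
      case True
      then show ?thesis
        using p c G.income_ratio_bounds[of p] H.income_ratio_bounds[of p] by auto
    next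
      case False
      have "2 * cdf_distance G H / (p * quantile_mean H) \<le> c" unfolding c_def
        using False H \<eta> distance_nonneg by (intro divide_left_mono) auto
      with False show ?thesis
        using income_ratio_diff[of p] p H \<eta> e by simp
    qed
  qed (use ind one int2 in \<open>auto intro: set_integral_add set_integrable_abs\<close>)
  also have "\<dots> = (LINT p:{0..1}|lborel. indicator {0..\<eta>} p) + c"
    using ind one by (subst set_integral_add(2)) (auto simp: set_lebesgue_integral_def)
  also have "(LINT p:{0..1}|lborel. indicator {0..\<eta>} p) \<le> \<eta>"
  proof -
    have "(LINT p:{0..1}|lborel. indicator {0..\<eta>} p) = (\<integral>p. indicator {0..min 1 \<eta>} p \<partial>lborel)"
      unfolding set_lebesgue_integral_def
      by (intro Bochner_Integration.integral_cong) (auto split: split_indicator)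
    also have "\<dots> \<le> \<eta>" using \<eta> by simp
    finally show ?thesis .
  qed
  finally show ?thesis by (simp add: c_def)
qed

end

section \<open>Empirical distributions\<close>

lemma indicator_Icc_right_continuous:
  fixes a :: real
  shows "((\<lambda>t. indicator {0..t} a :: real) \<longlongrightarrow> indicator {0..x} a) (at_right x)"
proof (rule tendsto_eventually)
  show "\<forall>\<^sub>F t in at_right x. indicator {0..t} a = (indicator {0..x} a :: real)"
  proof (cases "a \<le> x")
    case True
    show ?thesis
      using eventually_at_right_less[of x]
      by eventually_elim (use True in \<open>auto split: split_indicator\<close>)
  next
    case False
    then have "\<forall>\<^sub>F t in at_right x. t < a" by (intro order_tendstoD(2)[OF tendsto_ident_at]) simp
    then show ?thesis by eventually_elim (use False in \<open>auto split: split_indicator\<close>)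
  qed
qed

lemma defective_cdf_empirical: "defective_cdf (empirical_cdf n x)"
proof
  show "mono (empirical_cdf n x)" unfolding empirical_cdf_def
    by (intro monoI mult_left_mono sum_mono) (auto split: split_indicator)
  show "continuous (at_right t) (empirical_cdf n x)" for t
    unfolding continuous_within empirical_cdf_def by (intro tendsto_intros indicator_Icc_right_continuous)
  show "empirical_cdf n x t = 0" if "t < 0" for t using that by (simp add: empirical_cdf_def)
qed

lemma nonneg_cdf_empirical:
  assumes n: "1 \<le> n" and x: "\<And>i. i \<in> {1..n} \<Longrightarrow> 0 \<le> x i"
  shows "nonneg_cdf (empirical_cdf n x)"
proof -
  interpret defective_cdf "empirical_cdf n x" by (rule defective_cdf_empirical)
  define b where "b = Max (x ` {1..n})"
  have b: "x i \<le> b" if "i \<in> {1..n}" for i using that by (auto simp: b_def)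
  have one: "empirical_cdf n x t = 1" if "b \<le> t" for t
  proof -
    have "(\<Sum>i=1..n. indicator {0..t} (x i)) = (\<Sum>i=1..n. 1 :: real)"
    proof (rule sum.cong)
      fix i assume "i \<in> {1..n}"
      with b[of i] x[of i] that show "indicator {0..t} (x i) = (1 :: real)" by simp
    qed simp
    then show ?thesis using n by (simp add: empirical_cdf_def)
  qed
  have le: "empirical_cdf n x t \<le> 1" for t
    using monoD[OF mono, of t "max b t"] one[of "max b t"] by simp
  show ?thesis
  proof
    show "(empirical_cdf n x \<longlongrightarrow> 1) at_top"
      by (rule tendsto_eventually) (rule eventually_mono[OF eventually_ge_at_top[of b] one])
    show "set_integrable lborel {0..} (\<lambda>t. 1 - empirical_cdf n x t)"
    proof (rule set_integrable_bounded_by)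
      have "integrable lborel (indicat_real {0..b})"
        by (intro integrable_real_indicator) (simp_all add: emeasure_lborel_Icc_eq)
      then show "set_integrable lborel {0..} (indicat_real {0..b})"
        unfolding set_integrable_def by (rule integrable_mult_indicator[rotated]) simp
      show "\<bar>1 - empirical_cdf n x t\<bar> \<le> indicator {0..b} t" if "t \<in> {0..}" for t
        using that le[of t] nonneg[of t] one[of t] by (auto split: split_indicator)
    qed simp_all
  qed
qed

text \<open>The distance hypothesis excludes samples whose observations are all zero: their empirical cdf is
\<open>1\<close> on the half-line and has distance \<open>quantile_mean F\<close> from \<open>F\<close>. So the sample mean
is non-zero and can be cancelled.\<close>

lemma empirical_index_diff:
  assumes n: "1 \<le> n" and x: "\<And>i. i \<in> {1..n} \<Longrightarrow> 0 \<le> x i"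
    and "nonneg_cdf F" and \<eta>: "0 < \<eta>"
    and less: "cdf_distance (empirical_cdf n x) F < quantile_mean F"
  shows "\<bar>empirical_inequality_index n x - inequality_index F\<bar>
    \<le> \<eta> + 2 * cdf_distance (empirical_cdf n x) F / (\<eta> * quantile_mean F)"
proof -
  interpret F: nonneg_cdf F by fact
  interpret E: nonneg_cdf "empirical_cdf n x" by (rule nonneg_cdf_empirical[OF n x])
  interpret nonneg_cdf_pair "empirical_cdf n x" F ..
  have \<mu>: "0 < quantile_mean F" using less distance_nonneg by linarith
  have mean: "0 < quantile_mean (empirical_cdf n x)" using mean_diff less by linarith
  have "sample_mean n x \<noteq> 0"
  proof
    assume "sample_mean n x = 0"
    then have "(\<Sum>i\<in>{1..n}. x i) = 0" using n by (simp add: sample_mean_def)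
    then have "x i = 0" if "i \<in> {1..n}" for i
      using x that by (subst (asm) sum_nonneg_eq_0_iff) blast+
    then have "empirical_cdf n x t = 1" if "0 \<le> t" for t
      using n that by (simp add: empirical_cdf_def)
    then have "bottom_income (empirical_cdf n x) 1 = (LINT t:{0 :: real..}|lborel. (0 :: real))"
      unfolding bottom_income_def by (intro set_lebesgue_integral_cong) simp_all
    then have "quantile_mean (empirical_cdf n x) = 0" by (simp add: E.mean_eq)
    with mean show False by simp
  qed
  then have "empirical_inequality_index n x = (LINT p:{0..1}|lborel. 1 - income_ratio (empirical_cdf n x) p)"
    unfolding empirical_inequality_index_def
    by (intro E.integral_normalised_ratio[OF mean])
      (auto simp: empirical_dual_lorenz_def empirical_lorenz_def E.quantile_integral E.quantile_integral_top)
  then show ?thesis using F.inequality_index_eq[OF \<mu>] index_integral_diff[OF \<mu> \<eta>] by simp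
qed

section \<open>Measurability of the empirical index\<close>

lemma measurable_empirical_cdf:
  assumes Y: "\<And>i. 1 \<le> i \<Longrightarrow> (\<lambda>z. Y z i) \<in> borel_measurable K" and f [measurable]: "f \<in> borel_measurable K"
  shows "(\<lambda>z. empirical_cdf n (Y z) (f z)) \<in> borel_measurable K"
proof -
  have "(\<lambda>z. indicator {0..f z} (Y z i) :: real) \<in> borel_measurable K" if "i \<in> {1..n}" for i
  proof -
    have [measurable]: "(\<lambda>z. Y z i) \<in> borel_measurable K" using Y that by simp
    have "(\<lambda>z. if 0 \<le> Y z i \<and> Y z i \<le> f z then 1 else 0 :: real) \<in> borel_measurable K" by measurable
    then show ?thesis by (simp add: indicator_def)
  qed
  then show ?thesis unfolding empirical_cdf_def
    by (intro borel_measurable_times borel_measurable_const borel_measurable_sum)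
qed

lemma measurable_empirical_quantile_integral:
  fixes f g :: "'c \<Rightarrow> real"
  assumes Y: "\<And>i. 1 \<le> i \<Longrightarrow> (\<lambda>z. Y z i) \<in> borel_measurable K"
    and fg [measurable]: "f \<in> borel_measurable K" "g \<in> borel_measurable K"
  shows "(\<lambda>z. LINT s:{f z..g z}|lborel. quantile (empirical_cdf n (Y z)) s) \<in> borel_measurable K"
proof -
  have [measurable]: "(\<lambda>w. quantile (empirical_cdf n (Y (fst w))) (snd w)) \<in> borel_measurable (K \<Otimes>\<^sub>M lborel)"
  proof (rule borel_measurable_quantile)
    show "(\<lambda>w. empirical_cdf n (Y (fst w)) y) \<in> borel_measurable (K \<Otimes>\<^sub>M lborel)" for y
      by (rule measurable_empirical_cdf) (use Y in simp_all)
  qed (simp_all add: defective_cdf_empirical)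
  have "(\<lambda>w. (if f (fst w) \<le> snd w \<and> snd w \<le> g (fst w) then 1 else 0)
      * quantile (empirical_cdf n (Y (fst w))) (snd w)) \<in> borel_measurable (K \<Otimes>\<^sub>M lborel)"
    by measurable
  then have "(\<lambda>(z, s). indicator {f z..g z} s *\<^sub>R quantile (empirical_cdf n (Y z)) s)
      \<in> borel_measurable (K \<Otimes>\<^sub>M lborel)"
    by (simp add: indicator_def case_prod_beta of_bool_def)
  then show ?thesis unfolding set_lebesgue_integral_def
    by (rule lborel.borel_measurable_lebesgue_integral)
qed

lemma measurable_sample_mean:
  assumes "\<And>i. 1 \<le> i \<Longrightarrow> (\<lambda>z. Y z i) \<in> borel_measurable K"
  shows "(\<lambda>z. sample_mean n (Y z)) \<in> borel_measurable K"
  unfolding sample_mean_def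
  by (intro borel_measurable_times borel_measurable_const borel_measurable_sum assms) simp

lemma measurable_empirical_inequality_index:
  assumes Y: "\<And>i. 1 \<le> i \<Longrightarrow> (\<lambda>z. Y z i) \<in> borel_measurable K"
  shows "(\<lambda>z. empirical_inequality_index n (Y z)) \<in> borel_measurable K"
proof -
  let ?K = "K \<Otimes>\<^sub>M lborel"
  have Y': "(\<lambda>w. Y (fst w) i) \<in> borel_measurable ?K" if "1 \<le> i" for i
    using Y[OF that] by simp
  note [measurable] = measurable_sample_mean[OF Y', where n = n]
  have [measurable]: "(\<lambda>w. empirical_lorenz n (Y (fst w)) (snd w)) \<in> borel_measurable ?K"
    unfolding empirical_lorenz_def
    using measurable_empirical_quantile_integral[OF Y', where f = "\<lambda>_. 0" and g = snd and n = n] by measurable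
  have [measurable]: "(\<lambda>w. empirical_dual_lorenz n (Y (fst w)) (snd w)) \<in> borel_measurable ?K"
    unfolding empirical_dual_lorenz_def
    using measurable_empirical_quantile_integral[OF Y', where f = "\<lambda>w. 1 - snd w" and g = "\<lambda>_. 1" and n = n] by measurable
  have "(\<lambda>w. indicator {0..1} (snd w) *\<^sub>R
      ((empirical_dual_lorenz n (Y (fst w)) (snd w) - empirical_lorenz n (Y (fst w)) (snd w))
        / empirical_dual_lorenz n (Y (fst w)) (snd w))) \<in> borel_measurable ?K"
    by measurable
  then show ?thesis unfolding empirical_inequality_index_def set_lebesgue_integral_def
    by (intro lborel.borel_measurable_lebesgue_integral) (simp add: case_prod_beta)
qed

section \<open>Mean deviation of averages of independent variables\<close>

text \<open>Independence and centring remove the mixed terms from the second moment of the sum, and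
\<open>(E \<bar>S\<bar>)\<^sup>2 \<le> E S\<^sup>2\<close> because the variance of \<open>\<bar>S\<bar>\<close> is non-negative.\<close>

lemma (in prob_space) expectation_abs_mean_le:
  fixes Z :: "nat \<Rightarrow> 'a \<Rightarrow> real"
  assumes I: "finite I" "I \<noteq> {}" and ind: "indep_vars (\<lambda>_. borel) Z I"
    and le: "\<And>i \<omega>. i \<in> I \<Longrightarrow> \<bar>Z i \<omega>\<bar> \<le> 1" and mean: "\<And>i. i \<in> I \<Longrightarrow> expectation (Z i) = 0"
  shows "expectation (\<lambda>\<omega>. \<bar>1 / real (card I) * (\<Sum>i\<in>I. Z i \<omega>)\<bar>) \<le> 1 / sqrt (real (card I))"
proof -
  let ?n = "real (card I)"
  have n: "0 < ?n" using I by (simp add: card_gt_0_iff)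
  have rv: "Z i \<in> borel_measurable M" if "i \<in> I" for i
    using ind that by (simp add: indep_vars_def)
  have prod_le: "\<bar>Z i \<omega> * Z j \<omega>\<bar> \<le> 1" if "i \<in> I" "j \<in> I" for i j \<omega>
    using le[OF that(1), of \<omega>] le[OF that(2), of \<omega>] by (simp add: abs_mult mult_le_one)
  have int: "integrable M (Z i)" if "i \<in> I" for i
    using le[OF that] rv[OF that] by (intro integrable_const_bound[where B = 1]) auto
  have int2: "integrable M (\<lambda>\<omega>. Z i \<omega> * Z j \<omega>)" if "i \<in> I" "j \<in> I" for i j
    using prod_le[OF that] rv[OF that(1)] rv[OF that(2)]
    by (intro integrable_const_bound[where B = 1]) auto
  have cov: "expectation (\<lambda>\<omega>. Z i \<omega> * Z j \<omega>) \<le> (if i = j then 1 else 0)" if ij: "i \<in> I" "j \<in> I" for i j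
  proof (cases "i = j")
    case True
    have "expectation (\<lambda>\<omega>. Z i \<omega> * Z j \<omega>) \<le> expectation (\<lambda>_. 1)"
      using prod_le[OF ij] int2[OF ij] by (intro integral_mono) (auto simp: abs_le_iff)
    with True show ?thesis by (simp add: prob_space)
  next
    case False
    have "indep_vars (\<lambda>_. borel) Z {i, j}" by (rule indep_vars_subset[OF ind]) (use ij in auto)
    then have "expectation (\<lambda>\<omega>. \<Prod>k\<in>{i, j}. Z k \<omega>) = (\<Prod>k\<in>{i, j}. expectation (Z k))"
      by (intro indep_vars_lebesgue_integral) (use ij int in auto)
    with False mean ij show ?thesis by simp
  qed
  define S where "S \<omega> = 1 / ?n * (\<Sum>i\<in>I. Z i \<omega>)" for \<omega>
  have S2: "(S \<omega>)\<^sup>2 = 1 / ?n\<^sup>2 * (\<Sum>i\<in>I. \<Sum>j\<in>I. Z i \<omega> * Z j \<omega>)" for \<omega>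
    by (simp add: S_def power2_eq_square sum_product)
  have intS: "integrable M S" unfolding S_def[abs_def] using int by auto
  have intS2: "integrable M (\<lambda>\<omega>. (S \<omega>)\<^sup>2)" unfolding S2
    by (intro integrable_mult_right Bochner_Integration.integrable_sum int2)
  have "expectation (\<lambda>\<omega>. (S \<omega>)\<^sup>2) = 1 / ?n\<^sup>2 * (\<Sum>i\<in>I. \<Sum>j\<in>I. expectation (\<lambda>\<omega>. Z i \<omega> * Z j \<omega>))"
    unfolding S2 by (simp add: Bochner_Integration.integral_sum int2)
  also have "\<dots> \<le> 1 / ?n\<^sup>2 * (\<Sum>i\<in>I. \<Sum>j\<in>I. if i = j then 1 else 0)"
    using cov by (intro mult_left_mono sum_mono) auto
  also have "\<dots> = 1 / ?n" using I by (simp add: power2_eq_square)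
  finally have *: "expectation (\<lambda>\<omega>. (S \<omega>)\<^sup>2) \<le> 1 / ?n" .
  have "variance (\<lambda>\<omega>. \<bar>S \<omega>\<bar>) = expectation (\<lambda>\<omega>. (S \<omega>)\<^sup>2) - (expectation (\<lambda>\<omega>. \<bar>S \<omega>\<bar>))\<^sup>2"
    using intS intS2 by (subst variance_eq) auto
  then have "(expectation (\<lambda>\<omega>. \<bar>S \<omega>\<bar>))\<^sup>2 \<le> 1 / ?n"
    using variance_positive[of "\<lambda>\<omega>. \<bar>S \<omega>\<bar>"] * by simp
  then have "expectation (\<lambda>\<omega>. \<bar>S \<omega>\<bar>) \<le> sqrt (1 / ?n)" by (rule real_le_rsqrt)
  then show ?thesis by (simp add: S_def real_sqrt_divide)
qed

section \<open>The cdf of a non-negative random variable\<close>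

text \<open>The tail \<open>1 - F\<close> is integrable because its integral is the mean of \<open>X\<close>, by the layer-cake
decomposition of \<open>X\<close> and Tonelli's theorem.\<close>

lemma nonneg_cdf_of_random_variable:
  fixes X :: "'b \<Rightarrow> real"
  assumes "prob_space N" and X [measurable]: "X \<in> borel_measurable N" and nn: "AE \<omega> in N. 0 \<le> X \<omega>"
    and int: "integrable N X"
  shows "nonneg_cdf (cdf (distr N borel X))"
proof -
  interpret N: prob_space N by fact
  interpret D: real_distribution "distr N borel X" by (rule N.real_distribution_distr) simp
  let ?F = "cdf (distr N borel X)"
  have F: "?F x = measure N {\<omega> \<in> space N. X \<omega> \<le> x}" for x
    by (simp add: cdf_def measure_distr vimage_def Int_def conj_commute)
  have tail: "ennreal (1 - ?F x) = emeasure N {\<omega> \<in> space N. x < X \<omega>}" for x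
  proof -
    have "measure N {\<omega> \<in> space N. x < X \<omega>} = measure N (space N - {\<omega> \<in> space N. X \<omega> \<le> x})"
      by (rule arg_cong[where f = "measure N"]) auto
    also have "\<dots> = 1 - ?F x" by (subst N.prob_compl) (simp_all add: F)
    finally show ?thesis by (simp add: N.emeasure_eq_measure)
  qed
  interpret P: pair_sigma_finite N lborel ..
  interpret G: defective_cdf ?F
  proof
    show "mono ?F" by (intro monoI D.cdf_nondecreasing)
    show "continuous (at_right x) ?F" for x by (rule D.cdf_is_right_cont)
    show "?F x = 0" if "x < 0" for x
    proof -
      have "AE \<omega> in N. \<not> X \<omega> \<le> x" using nn by eventually_elim (use that in simp)
      then show ?thesis unfolding F by (intro N.prob_Collect_eq_0[THEN iffD2]) auto
    qed
  qed
  show ?thesis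
  proof
    show "(?F \<longlongrightarrow> 1) at_top" by (rule D.cdf_lim_at_top_prob)
    have "(\<integral>\<^sup>+x. ennreal (indicator {0..} x *\<^sub>R (1 - ?F x)) \<partial>lborel)
      = (\<integral>\<^sup>+x. \<integral>\<^sup>+\<omega>. (if 0 \<le> x \<and> x < X \<omega> then 1 else 0) \<partial>N \<partial>lborel)"
    proof (rule nn_integral_cong)
      fix x :: real
      have "(\<integral>\<^sup>+\<omega>. (if 0 \<le> x \<and> x < X \<omega> then 1 else 0) \<partial>N)
        = (\<integral>\<^sup>+\<omega>. indicator {0..} x * indicator {\<omega> \<in> space N. x < X \<omega>} \<omega> \<partial>N)"
        by (intro nn_integral_cong) (auto split: split_indicator)
      also have "\<dots> = indicator {0..} x * ennreal (1 - ?F x)"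
        by (subst nn_integral_cmult) (auto simp: tail)
      finally show "ennreal (indicator {0..} x *\<^sub>R (1 - ?F x))
          = (\<integral>\<^sup>+\<omega>. (if 0 \<le> x \<and> x < X \<omega> then 1 else 0) \<partial>N)"
        by (simp split: split_indicator)
    qed
    also have "\<dots> = (\<integral>\<^sup>+\<omega>. \<integral>\<^sup>+x. (if 0 \<le> x \<and> x < X \<omega> then 1 else 0) \<partial>lborel \<partial>N)"
      by (rule P.Fubini') simp
    also have "\<dots> = (\<integral>\<^sup>+\<omega>. ennreal (X \<omega>) \<partial>N)"
    proof (rule nn_integral_cong_AE, use nn in eventually_elim)
      fix \<omega> assume "0 \<le> X \<omega>"
      have "(\<integral>\<^sup>+x. (if 0 \<le> x \<and> x < X \<omega> then 1 else 0) \<partial>lborel) = (\<integral>\<^sup>+x. indicator {0..<X \<omega>} x \<partial>lborel)"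
        by (intro nn_integral_cong) (auto split: split_indicator)
      with \<open>0 \<le> X \<omega>\<close> show "(\<integral>\<^sup>+x. (if 0 \<le> x \<and> x < X \<omega> then 1 else 0) \<partial>lborel) = ennreal (X \<omega>)" by simp
    qed
    also have "\<dots> < \<infinity>" using int nn by (simp add: nn_integral_eq_integral)
    finally have fin: "(\<integral>\<^sup>+x. ennreal (indicator {0..} x *\<^sub>R (1 - ?F x)) \<partial>lborel) < \<infinity>" .
    have "0 \<le> indicator {0..} x *\<^sub>R (1 - ?F x)" for x
      using D.cdf_bounded_prob by simp
    with fin show "set_integrable lborel {0..} (\<lambda>x. 1 - ?F x)"
      unfolding set_integrable_def by (intro integrableI_nonneg) auto
  qed
qed

text \<open>Continuity at \<open>0\<close> forbids an atom there, so \<open>1 - G\<close> exceeds \<open>1/2\<close> on some interval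
\<open>[0, b)\<close> and contributes at least \<open>b/2\<close> to the mean.\<close>

lemma (in nonneg_cdf) quantile_mean_pos_if_continuous:
  assumes "continuous_on UNIV G"
  shows "0 < quantile_mean G"
proof -
  have "((\<lambda>x. G x) \<longlongrightarrow> G 0) (at_left 0)"
    using assms by (simp add: continuous_on_eq_continuous_at continuous_at_imp_continuous_within flip: continuous_within)
  moreover have "(G \<longlongrightarrow> 0) (at_left 0)"
    by (rule tendsto_eventually) (auto simp: eventually_at_filter zero_below intro!: always_eventually)
  ultimately have G0: "G 0 = 0"
    by (rule tendsto_unique[rotated]) simp
  have "(G \<longlongrightarrow> 0) (at_right 0)" using right_cont[of 0] G0 by (simp add: continuous_within)
  then have "\<forall>\<^sub>F x in at_right 0. G x < 1/2" by (rule order_tendstoD) simp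
  then obtain b where b: "0 < b" "\<And>x. 0 < x \<Longrightarrow> x < b \<Longrightarrow> G x < 1/2"
    unfolding eventually_at_right_field by blast
  have "b / 2 = (LINT x:{0..}|lborel. indicat_real {0..<b} x / 2)"
  proof -
    have "(LINT x:{0..}|lborel. indicat_real {0..<b} x / 2) = (\<integral>x. indicat_real {0..<b} x / 2 \<partial>lborel)"
      unfolding set_lebesgue_integral_def
      by (intro Bochner_Integration.integral_cong) (auto split: split_indicator)
    then show ?thesis using b by simp
  qed
  also have "\<dots> \<le> (LINT x:{0..}|lborel. max 0 (1 - G x))"
  proof (rule set_integral_mono)
    have half: "(1/2 :: real) \<le> 1 - G x" if "0 \<le> x" "x < b" for x
      using b(2)[of x] G0 that by (cases "x = 0") auto
    show "indicat_real {0..<b} x / 2 \<le> max 0 (1 - G x)" for x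
      using half[of x] by (auto split: split_indicator)
    show "set_integrable lborel {0..} (\<lambda>x. indicat_real {0..<b} x / 2)"
      by (rule set_integrable_bounded_by[OF integrable_tail])
        (use half le_1 in \<open>auto split: split_indicator\<close>)
  qed (rule integrable_bottom, simp)
  also have "\<dots> = quantile_mean G" by (simp add: mean_eq bottom_income_def)
  finally show ?thesis using b by simp
qed

section \<open>Mean deviation of the empirical cdf\<close>

locale iid_sample = prob_space M + F: nonneg_cdf F
  for M :: "'a measure" and F :: "real \<Rightarrow> real" +
  fixes Xs :: "nat \<Rightarrow> 'a \<Rightarrow> real"
  assumes indep: "indep_vars (\<lambda>_. borel) Xs {1..}"
    and cdf_eq: "1 \<le> i \<Longrightarrow> cdf (distr M borel (Xs i)) = F"
begin

abbreviation empirical :: "nat \<Rightarrow> 'a \<Rightarrow> real \<Rightarrow> real" where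
  "empirical n \<omega> \<equiv> empirical_cdf n (\<lambda>i. Xs i \<omega>)"

lemma rv: "1 \<le> i \<Longrightarrow> Xs i \<in> borel_measurable M"
  using indep by (simp add: indep_vars_def)

lemma prob_le:
  assumes "1 \<le> i" shows "prob {\<omega> \<in> space M. Xs i \<omega> \<le> x} = F x"
  using rv[OF assms]
  by (simp add: cdf_eq[OF assms, symmetric] cdf_def measure_distr vimage_def Int_def conj_commute)

text \<open>The cdf is given only pointwise, so the event \<open>Xs i < 0\<close> is exhausted by the null events
\<open>Xs i \<le> - 1 / (k + 1)\<close>.\<close>

lemma AE_nonneg: "AE \<omega> in M. \<forall>i\<in>{1..}. 0 \<le> Xs i \<omega>"
proof (rule AE_ball_countable')
  fix i :: nat assume "i \<in> {1..}"
  then have i: "1 \<le> i" by simp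
  note [measurable] = rv[OF i]
  have "AE \<omega> in M. \<not> Xs i \<omega> \<le> - 1 / Suc k" for k
  proof (rule prob_Collect_eq_0[THEN iffD1])
    have "F (- 1 / Suc k) = 0" by (rule F.zero_below) simp
    then show "prob {\<omega> \<in> space M. Xs i \<omega> \<le> - 1 / Suc k} = 0" by (simp add: prob_le[OF i])
  qed simp
  then have "AE \<omega> in M. \<forall>k. \<not> Xs i \<omega> \<le> - 1 / Suc k" by (simp add: AE_all_countable)
  then show "AE \<omega> in M. 0 \<le> Xs i \<omega>"
  proof eventually_elim
    fix \<omega> assume *: "\<forall>k. \<not> Xs i \<omega> \<le> - 1 / Suc k"
    show "0 \<le> Xs i \<omega>"
    proof (rule ccontr)
      assume "\<not> 0 \<le> Xs i \<omega>"
      then obtain k where "inverse (Suc k) < - Xs i \<omega>" using reals_Archimedean[of "- Xs i \<omega>"] by auto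
      with * show False by (auto simp: inverse_eq_divide dest!: spec[of _ k])
    qed
  qed
qed simp

lemma AE_nonneg_cdf: "AE \<omega> in M. \<forall>n\<ge>1. nonneg_cdf (empirical n \<omega>)"
  using AE_nonneg by eventually_elim (auto intro!: nonneg_cdf_empirical)

lemma measurable_empirical [measurable (raw)]:
  assumes "f \<in> measurable K M" "g \<in> borel_measurable K"
  shows "(\<lambda>z. empirical n (f z) (g z)) \<in> borel_measurable K"
  by (intro measurable_empirical_cdf measurable_compose[OF assms(1)] rv assms)

lemma expectation_indicator:
  assumes "1 \<le> i" "0 \<le> x" shows "expectation (\<lambda>\<omega>. indicator {0..x} (Xs i \<omega>)) = F x"
proof -
  note [measurable] = rv[OF assms(1)]
  have "expectation (\<lambda>\<omega>. indicat_real {0..x} (Xs i \<omega>))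
      = expectation (indicat_real {\<omega> \<in> space M. Xs i \<omega> \<le> x})"
  proof (rule integral_cong_AE)
    show "AE \<omega> in M. indicator {0..x} (Xs i \<omega>) = (indicator {\<omega> \<in> space M. Xs i \<omega> \<le> x} \<omega> :: real)"
      using AE_nonneg AE_space by eventually_elim (use assms in \<open>auto split: split_indicator\<close>)
  qed auto
  then show ?thesis using prob_le[OF assms(1)] by simp
qed

lemma integrable_indicator:
  "1 \<le> i \<Longrightarrow> integrable M (\<lambda>\<omega>. indicator {0..x} (Xs i \<omega>) :: real)"
  using rv[of i] by (intro integrable_const_bound[where B = 1]) (auto split: split_indicator)

lemma integrable_empirical: "integrable M (\<lambda>\<omega>. empirical n \<omega> x)"
  unfolding empirical_cdf_def
  by (intro integrable_mult_right Bochner_Integration.integrable_sum integrable_indicator) simp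

lemma expectation_empirical:
  assumes "1 \<le> n" "0 \<le> x" shows "expectation (\<lambda>\<omega>. empirical n \<omega> x) = F x"
  using assms
  by (simp add: empirical_cdf_def Bochner_Integration.integral_sum integrable_indicator expectation_indicator)

definition expected_deviation :: "nat \<Rightarrow> real \<Rightarrow> real" where
  "expected_deviation n x = expectation (\<lambda>\<omega>. \<bar>empirical n \<omega> x - F x\<bar>)"

lemma deviation_le_sqrt:
  assumes "1 \<le> n" "0 \<le> x" shows "expected_deviation n x \<le> 1 / sqrt n"
proof -
  have "expectation (\<lambda>\<omega>. \<bar>1 / real (card {1..n}) * (\<Sum>i\<in>{1..n}. indicator {0..x} (Xs i \<omega>) - F x)\<bar>)
      \<le> 1 / sqrt (real (card {1..n}))"
  proof (rule expectation_abs_mean_le)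
    have "indep_vars (\<lambda>_. borel) Xs {1..n}" by (rule indep_vars_subset[OF indep]) auto
    then show "indep_vars (\<lambda>_. borel) (\<lambda>i \<omega>. indicator {0..x} (Xs i \<omega>) - F x) {1..n}"
      by (rule indep_vars_compose2) simp
    show "\<bar>indicator {0..x} (Xs i \<omega>) - F x\<bar> \<le> 1" for i \<omega>
      using F.nonneg[of x] F.le_1[of x] by (auto split: split_indicator)
    show "expectation (\<lambda>\<omega>. indicator {0..x} (Xs i \<omega>) - F x) = 0" if "i \<in> {1..n}" for i
      using that expectation_indicator[of i x] integrable_indicator[of i x] assms by (simp add: prob_space)
  qed (use assms in auto)
  moreover have "1 / real (card {1..n}) * (\<Sum>i\<in>{1..n}. indicator {0..x} (Xs i \<omega>) - F x) = empirical n \<omega> x - F x" for \<omega>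
    using assms by (simp add: empirical_cdf_def sum_subtractf field_simps)
  ultimately have "expectation (\<lambda>\<omega>. \<bar>empirical n \<omega> x - F x\<bar>) \<le> 1 / sqrt (real (card {1..n}))"
    by (simp only:)
  then show ?thesis by (simp add: expected_deviation_def)
qed

text \<open>This bound does not tend to \<open>0\<close> but is integrable in \<open>x\<close>, whereas the previous one
tends to \<open>0\<close> but is not integrable. Dominated convergence combines them.\<close>

lemma deviation_le_tail:
  assumes "1 \<le> n" "0 \<le> x" shows "expected_deviation n x \<le> 2 * (1 - F x)"
proof -
  have "expected_deviation n x \<le> expectation (\<lambda>\<omega>. (1 - empirical n \<omega> x) + (1 - F x))"
    unfolding expected_deviation_def
  proof (rule integral_mono_AE)
    show "AE \<omega> in M. \<bar>empirical n \<omega> x - F x\<bar> \<le> (1 - empirical n \<omega> x) + (1 - F x)"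
      using AE_nonneg_cdf
    proof eventually_elim
      fix \<omega> assume "\<forall>n\<ge>1. nonneg_cdf (empirical n \<omega>)"
      then interpret E: nonneg_cdf "empirical n \<omega>" using assms by blast
      show "\<bar>empirical n \<omega> x - F x\<bar> \<le> (1 - empirical n \<omega> x) + (1 - F x)"
        using E.le_1[of x] F.le_1[of x] by linarith
    qed
  qed (use integrable_empirical in auto)
  also have "\<dots> = 2 * (1 - F x)"
    using expectation_empirical[OF assms] integrable_empirical[of n x] by (simp add: prob_space)
  finally show ?thesis .
qed

section \<open>Convergence of the empirical distribution and of the index\<close>

text \<open>The distance is taken in \<^typ>\<open>ennreal\<close> so that it is meaningful at every sample point. It is
infinite when some of the \<open>n\<close> observations are negative, and Tonelli's theorem and
Markov's inequality apply without integrability conditions.\<close>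

definition nn_distance :: "nat \<Rightarrow> 'a \<Rightarrow> ennreal" where
  "nn_distance n \<omega> = (\<integral>\<^sup>+x. ennreal (indicator {0..} x * \<bar>empirical n \<omega> x - F x\<bar>) \<partial>lborel)"

lemma measurable_nn_distance [measurable]: "nn_distance n \<in> borel_measurable M"
  unfolding nn_distance_def[abs_def] by measurable

lemma nn_distance_eq:
  assumes "nonneg_cdf (empirical n \<omega>)"
  shows "nn_distance n \<omega> = ennreal (cdf_distance (empirical n \<omega>) F)"
proof -
  interpret E: nonneg_cdf "empirical n \<omega>" by fact
  interpret nonneg_cdf_pair "empirical n \<omega>" F ..
  show ?thesis unfolding nn_distance_def cdf_distance_def set_lebesgue_integral_def real_scaleR_def
    using integrable_distance by (intro nn_integral_eq_integral) (auto simp: set_integrable_def)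
qed

lemma expected_distance_eq:
  "(\<integral>\<^sup>+\<omega>. nn_distance n \<omega> \<partial>M) = (\<integral>\<^sup>+x. ennreal (indicator {0..} x * expected_deviation n x) \<partial>lborel)"
proof -
  interpret P: pair_sigma_finite M lborel ..
  have "(\<integral>\<^sup>+\<omega>. nn_distance n \<omega> \<partial>M)
      = (\<integral>\<^sup>+x. \<integral>\<^sup>+\<omega>. ennreal (indicator {0..} x * \<bar>empirical n \<omega> x - F x\<bar>) \<partial>M \<partial>lborel)"
    unfolding nn_distance_def by (rule P.Fubini'[symmetric]) measurable
  also have "\<dots> = (\<integral>\<^sup>+x. ennreal (indicator {0..} x * expected_deviation n x) \<partial>lborel)"
  proof (rule nn_integral_cong)
    fix x :: real
    have "integrable M (\<lambda>\<omega>. indicator {0..} x * \<bar>empirical n \<omega> x - F x\<bar>)"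
      using integrable_empirical by auto
    then show "(\<integral>\<^sup>+\<omega>. ennreal (indicator {0..} x * \<bar>empirical n \<omega> x - F x\<bar>) \<partial>M)
        = ennreal (indicator {0..} x * expected_deviation n x)"
      by (subst nn_integral_eq_integral) (auto simp: expected_deviation_def)
  qed
  finally show ?thesis .
qed

text \<open>A law of large numbers in Wasserstein distance that assumes only a finite mean. The index is
shifted by one because the dominating function is not available for the empty sample.\<close>

lemma expected_distance_tendsto_0: "(\<lambda>n. \<integral>\<^sup>+\<omega>. nn_distance n \<omega> \<partial>M) \<longlonglongrightarrow> 0"
proof -
  have "(\<lambda>n. \<integral>\<^sup>+x. ennreal (indicator {0..} x * expected_deviation (Suc n) x) \<partial>lborel)
      \<longlonglongrightarrow> (\<integral>\<^sup>+(x :: real). 0 \<partial>lborel)"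
  proof (rule nn_integral_dominated_convergence[where u' = "\<lambda>_. 0"
        and w = "\<lambda>x. ennreal (indicator {0..} x * (2 * (1 - F x)))"])
    show "(\<lambda>x. ennreal (indicator {0..} x * expected_deviation (Suc n) x)) \<in> borel_measurable lborel" for n
      unfolding expected_deviation_def by measurable
    show "AE x in lborel. ennreal (indicator {0..} x * expected_deviation (Suc n) x)
        \<le> ennreal (indicator {0..} x * (2 * (1 - F x)))" for n
      using deviation_le_tail[of "Suc n"] by (intro AE_I2 ennreal_leI) (auto split: split_indicator)
    have "set_integrable lborel {0..} (\<lambda>x. 2 * (1 - F x))"
      using F.integrable_tail by (rule set_integrable_mult_right)
    then show "(\<integral>\<^sup>+x. ennreal (indicator {0..} x * (2 * (1 - F x))) \<partial>lborel) < \<infinity>"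
      using F.le_1 by (subst nn_integral_eq_integral) (auto simp: set_integrable_def)
    show "AE x in lborel. (\<lambda>n. ennreal (indicator {0..} x * expected_deviation (Suc n) x)) \<longlonglongrightarrow> 0"
    proof (rule AE_I2)
      fix x :: real
      have "(\<lambda>n. indicator {0..} x * expected_deviation (Suc n) x) \<longlonglongrightarrow> 0"
      proof (rule tendsto_sandwich)
        show "\<forall>\<^sub>F n in sequentially. 0 \<le> indicator {0..} x * expected_deviation (Suc n) x"
          by (intro always_eventually allI mult_nonneg_nonneg) (simp_all add: expected_deviation_def)
        show "\<forall>\<^sub>F n in sequentially. indicator {0..} x * expected_deviation (Suc n) x \<le> 1 / sqrt (Suc n)"
          using deviation_le_sqrt[of "Suc _" x] by (intro always_eventually allI) (auto split: split_indicator)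
        have "(\<lambda>n. 1 / sqrt (real n)) \<longlonglongrightarrow> 0"
          by (intro tendsto_divide_0[OF tendsto_const] filterlim_at_top_imp_at_infinity
              filterlim_compose[OF sqrt_at_top filterlim_real_sequentially])
        then show "(\<lambda>n. 1 / sqrt (Suc n)) \<longlonglongrightarrow> 0" by (rule LIMSEQ_Suc)
      qed simp
      then show "(\<lambda>n. ennreal (indicator {0..} x * expected_deviation (Suc n) x)) \<longlonglongrightarrow> 0"
        using tendsto_ennrealI by fastforce
    qed
  qed simp_all
  then have "(\<lambda>n. \<integral>\<^sup>+\<omega>. nn_distance (Suc n) \<omega> \<partial>M) \<longlonglongrightarrow> 0"
    by (simp add: expected_distance_eq)
  then show ?thesis by (rule LIMSEQ_imp_Suc)
qed

text \<open>Taking \<open>\<eta> = \<epsilon> / 2\<close> in the stability bound, an index error above \<open>\<epsilon>\<close> forces the distance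
to be at least \<open>min \<mu> (\<epsilon>\<^sup>2 \<mu> / 8)\<close>: the first value guards against a zero sample mean, the
second makes the remaining term \<open>4 d / (\<epsilon> \<mu>)\<close> at most \<open>\<epsilon> / 2\<close>. Markov's inequality does the rest.\<close>

lemma prob_index_deviation_le:
  assumes \<mu>: "0 < quantile_mean F" and \<epsilon>: "0 < \<epsilon>" and n: "1 \<le> n"
  shows "emeasure M {\<omega> \<in> space M. \<bar>empirical_inequality_index n (\<lambda>i. Xs i \<omega>) - inequality_index F\<bar> > \<epsilon>}
    \<le> ennreal (1 / min (quantile_mean F) (\<epsilon>\<^sup>2 * quantile_mean F / 8)) * (\<integral>\<^sup>+\<omega>. nn_distance n \<omega> \<partial>M)"
proof -
  let ?\<mu> = "quantile_mean F"
  define \<delta> where "\<delta> = min ?\<mu> (\<epsilon>\<^sup>2 * ?\<mu> / 8)"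
  have \<delta>: "0 < \<delta>" using \<mu> \<epsilon> by (simp add: \<delta>_def)
  have "emeasure M {\<omega> \<in> space M. \<bar>empirical_inequality_index n (\<lambda>i. Xs i \<omega>) - inequality_index F\<bar> > \<epsilon>}
     \<le> emeasure M ({\<omega> \<in> space M. 1 \<le> ennreal (1 / \<delta>) * nn_distance n \<omega>})"
  proof (rule emeasure_mono_AE)
    show "AE \<omega> in M. \<omega> \<in> {\<omega> \<in> space M. \<bar>empirical_inequality_index n (\<lambda>i. Xs i \<omega>) - inequality_index F\<bar> > \<epsilon>} \<longrightarrow>
      \<omega> \<in> {\<omega> \<in> space M. 1 \<le> ennreal (1 / \<delta>) * nn_distance n \<omega>}"
      using AE_nonneg
    proof (eventually_elim, intro impI)
      fix \<omega> assume nn: "\<forall>i\<in>{1..}. 0 \<le> Xs i \<omega>"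
        and \<omega>: "\<omega> \<in> {\<omega> \<in> space M. \<bar>empirical_inequality_index n (\<lambda>i. Xs i \<omega>) - inequality_index F\<bar> > \<epsilon>}"
      let ?d = "cdf_distance (empirical n \<omega>) F"
      have nn': "0 \<le> Xs i \<omega>" if "i \<in> {1..n}" for i using nn that by simp
      have E: "nonneg_cdf (empirical n \<omega>)" using n nn' by (rule nonneg_cdf_empirical)
      have "\<delta> \<le> ?d"
      proof (rule ccontr)
        assume "\<not> \<delta> \<le> ?d"
        then have d: "?d < ?\<mu>" "?d \<le> \<epsilon>\<^sup>2 * ?\<mu> / 8" by (auto simp: \<delta>_def)
        have "\<bar>empirical_inequality_index n (\<lambda>i. Xs i \<omega>) - inequality_index F\<bar>
            \<le> \<epsilon> / 2 + 2 * ?d / (\<epsilon> / 2 * ?\<mu>)"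
          by (rule empirical_index_diff[OF n nn' F.nonneg_cdf_axioms _ d(1)]) (use \<epsilon> in simp_all)
        also have "2 * ?d / (\<epsilon> / 2 * ?\<mu>) \<le> 2 * (\<epsilon>\<^sup>2 * ?\<mu> / 8) / (\<epsilon> / 2 * ?\<mu>)"
          using d(2) \<epsilon> \<mu> by (intro divide_right_mono mult_left_mono) auto
        also have "\<dots> = \<epsilon> / 2" using \<epsilon> \<mu> by (simp add: power2_eq_square)
        finally show False using \<omega> by simp
      qed
      then have "1 \<le> 1 / \<delta> * ?d" using \<delta> by (simp add: field_simps)
      then have "ennreal 1 \<le> ennreal (1 / \<delta> * ?d)" by (rule ennreal_leI)
      also have "\<dots> = ennreal (1 / \<delta>) * nn_distance n \<omega>"
        unfolding nn_distance_eq[OF E] using \<delta> by (intro ennreal_mult') simp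
      finally have "1 \<le> ennreal (1 / \<delta>) * nn_distance n \<omega>" by simp
      with \<omega> show "\<omega> \<in> {\<omega> \<in> space M. 1 \<le> ennreal (1 / \<delta>) * nn_distance n \<omega>}" by simp
    qed
  qed measurable
  also have "\<dots> \<le> ennreal (1 / \<delta>) * (\<integral>\<^sup>+\<omega>. nn_distance n \<omega> \<partial>M)"
    using nn_integral_Markov_inequality[of "nn_distance n" "space M" M "ennreal (1 / \<delta>)"]
    by (simp add: Int_absorb2 Int_def conj_commute cong: nn_integral_cong)
  finally show ?thesis by (simp add: \<delta>_def)
qed

lemma index_converges:
  assumes "0 < quantile_mean F"
  shows "converges_in_probability M (\<lambda>n \<omega>. empirical_inequality_index n (\<lambda>i. Xs i \<omega>)) (inequality_index F)"
  unfolding converges_in_probability_def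
proof (intro conjI allI impI)
  show "(\<lambda>\<omega>. empirical_inequality_index n (\<lambda>i. Xs i \<omega>)) \<in> borel_measurable M" for n
    by (rule measurable_empirical_inequality_index) (rule rv)
  fix \<epsilon> :: real assume \<epsilon>: "0 < \<epsilon>"
  define A where "A n = {\<omega> \<in> space M. \<bar>empirical_inequality_index n (\<lambda>i. Xs i \<omega>) - inequality_index F\<bar> > \<epsilon>}" for n
  define c where "c = 1 / min (quantile_mean F) (\<epsilon>\<^sup>2 * quantile_mean F / 8)"
  have "(\<lambda>n. emeasure M (A n)) \<longlonglongrightarrow> 0"
  proof (rule tendsto_sandwich[OF _ _ tendsto_const])
    show "\<forall>\<^sub>F n in sequentially. emeasure M (A n) \<le> ennreal c * (\<integral>\<^sup>+\<omega>. nn_distance n \<omega> \<partial>M)"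
      using eventually_ge_at_top[of 1]
      by eventually_elim (unfold A_def c_def, rule prob_index_deviation_le[OF assms \<epsilon>])
    show "(\<lambda>n. ennreal c * (\<integral>\<^sup>+\<omega>. nn_distance n \<omega> \<partial>M)) \<longlonglongrightarrow> 0"
      using ennreal_tendsto_cmult[OF _ expected_distance_tendsto_0, of "ennreal c"] by simp
  qed simp
  then have "(\<lambda>n. ennreal (prob (A n))) \<longlonglongrightarrow> ennreal 0" by (simp add: emeasure_eq_measure)
  then show "(\<lambda>n. prob {\<omega> \<in> space M. \<bar>empirical_inequality_index n (\<lambda>i. Xs i \<omega>) - inequality_index F\<bar> > \<epsilon>}) \<longlonglongrightarrow> 0"
    unfolding A_def by (rule tendsto_ennrealD) auto
qed

end

theorem theorem3p1:
  fixes N :: "'b measure" and X :: "'b \<Rightarrow> real" and F :: "real \<Rightarrow> real"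
    and M :: "'a measure" and Xs :: "nat \<Rightarrow> 'a \<Rightarrow> real"
  assumes "prob_space N"
    and "X \<in> borel_measurable N"
    and "AE \<omega> in N. X \<omega> \<ge> 0"
    and "F = cdf (distr N borel X)"
    and "continuous_on UNIV F"
    and "integrable N X"
    and "prob_space M"
    and "prob_space.indep_vars M (\<lambda>_. borel) Xs {1..}"
    and "\<And>i. i \<ge> 1 \<Longrightarrow> distr M borel (Xs i) = distr N borel X"
  shows "converges_in_probability M
           (\<lambda>n \<omega>. empirical_inequality_index n (\<lambda>i. Xs i \<omega>)) (inequality_index F)"
proof -
  interpret M: prob_space M by fact
  interpret F: nonneg_cdf F
    unfolding assms(4) using assms(1,2,3,6) by (rule nonneg_cdf_of_random_variable)
  interpret iid_sample M F Xs
    by unfold_locales (use assms(4,8,9) in simp_all)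
  show ?thesis by (rule index_converges[OF F.quantile_mean_pos_if_continuous[OF assms(5)]])
qed

end
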